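(* There exists a bijection between the set of binary codes of the form $x_1\cdots x_j$, with $j\in\mathbb{Z}^+$ and $x_i\in\{0,1\}$, such that $\mathrm{wgt}(x_1\cdots x_j)<j$, and the set of Fibonacci expansions of the form $aF_k+bF_{k+2}$ with $a,b\in\mathbb{Z}^+$, $\gcd(a,b)=1$ and $k\in\mathbb{Z}_{\ge 2}$.
   Context: $(F_m)$ is the Fibonacci sequence with $F_1=F_2=1$ and $F_{m+2}=F_{m+1}+F_m$. The weight $\mathrm{wgt}(\mathbf{t})$ of a binary code $\mathbf{t}$ is the number of ones in $\mathbf{t}$. A Fibonacci expansion is a representation of an integer as a sum of Fibonacci numbers; the expansion $aF_k+bF_{k+2}$ is regarded as a formal expression, i.e. it is determined by the triple $(a,b,k)$. *)

theory Defs
  imports "HOL-Number_Theory.Fib"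
begin

definition binary_codes :: "nat list set" where
  "binary_codes = {xs. length xs \<ge> 1 \<and> (\<forall>x \<in> set xs. x \<in> {0, 1})}"

definition wgt :: "nat list \<Rightarrow> nat" where
  "wgt xs = count_list xs 1"

text \<open>
  \<open>Fib_Expansion a b k\<close> is the formal expression \<open>a F\<^sub>k + b F\<^sub>k\<^sub>+\<^sub>2\<close>. Distinct triples are
  distinct expansions, even when they represent the same number.
\<close>

datatype fib_expansion = Fib_Expansion nat nat nat

text \<open>
  The number represented by an expansion. The library's \<open>fib\<close> has \<open>fib 1 = fib 2 = 1\<close>.
\<close>

fun expansion_value :: "fib_expansion \<Rightarrow> nat" where
  "expansion_value (Fib_Expansion a b k) = a * fib k + b * fib (k + 2)"

end

theory Submission
  imports Defs
begin

text \<open>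
  A code with fewer ones than letters contains a zero, so it factors uniquely as \<open>1\<^sup>m0w\<close>,
  where \<open>w\<close> is an arbitrary, possibly empty, binary word: the first zero marks the place to cut.
  An expansion \<open>aF\<^sub>k + bF\<^sub>k\<^sub>+\<^sub>2\<close> consists of an index \<open>k \<ge> 2\<close> and a coprime pair \<open>(a, b)\<close>.
  The number \<open>m\<close> of leading ones therefore encodes the index as \<open>k = m + 2\<close>, and it remains to
  match the words \<open>w\<close> with the coprime pairs.

  This is done by the Calkin--Wilf tree, which is the subtractive Euclidean algorithm run
  backwards. Starting from \<open>(1, 1)\<close>, each letter adds one entry to the other and thereby keeps the
  pair coprime. Comparing the entries of the result reveals the outermost letter, so
  the word can be read off the pair (\<open>inj_on_calkin_wilf\<close>); and subtracting the smaller entry from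
  the larger leads from any coprime pair of positive numbers down to \<open>(1, 1)\<close>, so every such
  pair occurs (\<open>calkin_wilf_surj\<close>).
\<close>

fun calkin_wilf :: "nat list \<Rightarrow> nat \<times> nat" where
  "calkin_wilf [] = (1, 1)"
| "calkin_wilf (x # xs) =
     (let (a, b) = calkin_wilf xs in if x = 0 then (a + b, b) else (a, a + b))"

lemma calkin_wilf_coprime_pos:
  "fst (calkin_wilf w) \<ge> 1 \<and> snd (calkin_wilf w) \<ge> 1 \<and>
   gcd (fst (calkin_wilf w)) (snd (calkin_wilf w)) = 1"
  by (induction w) (auto simp: case_prod_beta Let_def)

text \<open>
  Since both entries of the preceding pair are positive, the first entry of the new pair is the
  larger one after the letter \<open>0\<close>, the second one after the letter \<open>1\<close>, and the two are equal only
  at the root \<open>(1, 1)\<close>.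
\<close>

lemma inj_on_calkin_wilf: "inj_on calkin_wilf (lists {0, 1})"
proof -
  have "v = w" if "v \<in> lists {0, 1}" "w \<in> lists {0, 1}" "calkin_wilf v = calkin_wilf w" for v w
    using that
  proof (induction v arbitrary: w rule: list.induct)
    case Nil
    then show ?case
    proof (cases w)
      case (Cons y ys)
      with Nil calkin_wilf_coprime_pos[of ys] show ?thesis
        by (auto simp: case_prod_beta Let_def split: if_splits)
    qed simp
  next
    case (Cons x xs)
    note pos = calkin_wilf_coprime_pos[of xs]
    show ?case
    proof (cases w)
      case Nil
      with Cons.prems pos show ?thesis
        by (auto simp: case_prod_beta Let_def split: if_splits)
    next
      case w: (Cons y ys)
      have "x \<in> {0, 1}" "y \<in> {0, 1}"
        using Cons.prems(1,2) w by auto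
      then have "x = y \<and> calkin_wilf xs = calkin_wilf ys"
        using Cons.prems(3) w pos calkin_wilf_coprime_pos[of ys]
        by (auto simp: case_prod_beta Let_def prod_eq_iff split: if_splits)
      with Cons w show ?thesis by auto
    qed
  qed
  then show ?thesis by (rule inj_onI)
qed

text \<open>Each subtraction step of the Euclidean algorithm supplies one letter of the word.\<close>

lemma calkin_wilf_surj:
  assumes "a \<ge> 1" "b \<ge> 1" "gcd a b = 1"
  shows "\<exists>w \<in> lists {0, 1}. calkin_wilf w = (a, b)"
  using assms
proof (induction "a + b" arbitrary: a b rule: less_induct)
  case less
  consider "a = b" | "b < a" | "a < b" by linarith
  then show ?case
  proof cases
    case 1
    with less.prems have "calkin_wilf [] = (a, b)" by simp
    then show ?thesis by blast
  next
    case 2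
    have "gcd (a - b) b = 1"
      using 2 less.prems gcd_diff1_nat[of b a] by simp
    then obtain w where "w \<in> lists {0, 1}" "calkin_wilf w = (a - b, b)"
      using less.hyps[of "a - b" b] 2 less.prems by (auto simp: Suc_le_eq)
    then have "0 # w \<in> lists {0, 1}" "calkin_wilf (0 # w) = (a, b)"
      using 2 by auto
    then show ?thesis by blast
  next
    case 3
    have "gcd a (b - a) = 1"
      using 3 less.prems gcd_diff1_nat[of a b] by (simp add: gcd.commute)
    then obtain w where "w \<in> lists {0, 1}" "calkin_wilf w = (a, b - a)"
      using less.hyps[of a "b - a"] 3 less.prems by (auto simp: Suc_le_eq)
    then have "1 # w \<in> lists {0, 1}" "calkin_wilf (1 # w) = (a, b)"
      using 3 by auto
    then show ?thesis by blast
  qed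
qed

lemma wgt_less_length_iff:
  assumes "xs \<in> lists {0, 1}"
  shows "wgt xs < length xs \<longleftrightarrow> 0 \<in> set xs"
  using assms
proof (induction xs)
  case Nil
  then show ?case by (simp add: wgt_def)
next
  case (Cons x xs)
  moreover have "wgt xs \<le> length xs"
    by (simp add: wgt_def count_le_length)
  ultimately show ?case by (auto simp: wgt_def)
qed

text \<open>The factor \<open>1\<^sup>m\<close> is recovered as the longest prefix consisting of ones.\<close>

lemma bij_betw_first_zero:
  "bij_betw (\<lambda>(m, w). replicate m 1 @ 0 # w) (UNIV \<times> lists {0, 1})
     {xs \<in> binary_codes. wgt xs < length xs}"
    (is "bij_betw ?h ?P ?C")
proof -
  have codes: "?C = {xs \<in> lists {0, 1}. 0 \<in> set xs}"
  proof -
    have "xs \<in> binary_codes \<longleftrightarrow> xs \<in> lists {0, 1} \<and> xs \<noteq> []" for xs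
      by (cases xs) (auto simp: binary_codes_def)
    then show ?thesis using wgt_less_length_iff by auto
  qed
  have "inj_on ?h ?P"
  proof (rule inj_onI, clarify)
    fix m n :: nat and v w :: "nat list"
    assume eq: "replicate m 1 @ 0 # v = replicate n 1 @ 0 # w"
    have prefix: "takeWhile (\<lambda>x. x = 1) (replicate l 1 @ 0 # u) = replicate l 1"
      for l and u :: "nat list"
      by (induction l) auto
    have "replicate m (1::nat) = replicate n 1"
      using arg_cong[OF eq, of "takeWhile (\<lambda>x. x = 1)"] by (simp only: prefix)
    then have "m = n" by (metis length_replicate)
    with eq show "m = n \<and> v = w" by simp
  qed
  moreover have "?h ` ?P = ?C"
    unfolding codes
  proof (intro equalityI subsetI)
    fix xs assume "xs \<in> ?h ` ?P"
    then show "xs \<in> {xs \<in> lists {0, 1}. 0 \<in> set xs}" by auto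
  next
    fix xs :: "nat list" assume xs: "xs \<in> {xs \<in> lists {0, 1}. 0 \<in> set xs}"
    then obtain ys w where split: "xs = ys @ 0 # w" "0 \<notin> set ys"
      by (metis (mono_tags, lifting) mem_Collect_eq split_list_first)
    with xs have "\<forall>y \<in> set ys. y = 1" by auto
    then have "ys = replicate (length ys) 1"
      by (simp add: replicate_length_same)
    with split have "xs = ?h (length ys, w)" by simp
    moreover have "(length ys, w) \<in> ?P" using xs split by auto
    ultimately show "xs \<in> ?h ` ?P" by (rule image_eqI)
  qed
  ultimately show ?thesis by (rule bij_betw_imageI)
qed

lemma bij_betw_index_calkin_wilf:
  "bij_betw (\<lambda>(m, w). Fib_Expansion (fst (calkin_wilf w)) (snd (calkin_wilf w)) (m + 2))
     (UNIV \<times> lists {0, 1})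
     {Fib_Expansion a b k | a b k. a \<ge> 1 \<and> b \<ge> 1 \<and> gcd a b = 1 \<and> k \<ge> 2}"
    (is "bij_betw ?g ?P ?E")
proof (rule bij_betw_imageI)
  show "inj_on ?g ?P"
  proof (rule inj_onI)
    fix p q assume pq: "p \<in> ?P" "q \<in> ?P" and eq: "?g p = ?g q"
    then have "calkin_wilf (snd p) = calkin_wilf (snd q)"
      by (simp add: case_prod_beta prod_eq_iff)
    then have "snd p = snd q"
      by (rule inj_onD[OF inj_on_calkin_wilf]) (use pq in auto)
    with eq show "p = q" by (simp add: case_prod_beta prod_eq_iff)
  qed
next
  show "?g ` ?P = ?E"
  proof (intro equalityI subsetI)
    fix e assume "e \<in> ?g ` ?P"
    then show "e \<in> ?E" using calkin_wilf_coprime_pos by auto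
  next
    fix e assume "e \<in> ?E"
    then obtain a b k where e: "e = Fib_Expansion a b k"
      and ab: "a \<ge> 1" "b \<ge> 1" "gcd a b = 1" and k: "k \<ge> 2"
      by auto
    obtain w where w: "w \<in> lists {0, 1}" "calkin_wilf w = (a, b)"
      using calkin_wilf_surj[OF ab] by blast
    with e k have "e = ?g (k - 2, w)" by simp
    moreover have "(k - 2, w) \<in> ?P" using w by simp
    ultimately show "e \<in> ?g ` ?P" by (rule image_eqI)
  qed
qed

theorem theorem3p1:
  "\<exists>f :: nat list \<Rightarrow> fib_expansion.
     bij_betw f
       {xs \<in> binary_codes. wgt xs < length xs}
       {Fib_Expansion a b k | a b k. a \<ge> 1 \<and> b \<ge> 1 \<and> gcd a b = 1 \<and> k \<ge> 2}"
  using bij_betw_trans[OF bij_betw_inv_into[OF bij_betw_first_zero] bij_betw_index_calkin_wilf]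
  by blast

end
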